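(* Let $\mathbb{F}$ be a field containing a subfield isomorphic to $\mathbb{Q}$. Let $\mathscr{U}$ be the unital associative $\mathbb{F}$-algebra with generators $x,y$ and relation $xy-yx=x$, regarded as a Lie algebra under the commutator bracket, and let $\mathscr{R}$ be the Lie subalgebra of $\mathscr{U}$ that is the $\mathbb{F}$-linear span of the elements $x^ky$, $k\geq 1$. Then the Lie algebra $\mathscr{R}$ has a presentation with generators $u,v$ (where $u$ corresponds to $xy$ and $v$ to $x^2y$) and relations $\alpha_n=0$ for all integers $n\geq 1$, where $$\alpha_n = \llbracket vu^{n-1}vu^n\rrbracket + \frac{n!(n-1)!}{(2n+1)!}\llbracket vu^{2n+1}\rrbracket .$$ That is, the Lie algebra homomorphism $\mathfrak{L}\to\mathscr{R}$ from the free Lie algebra $\mathfrak{L}$ over $\mathbb{F}$ on $\{u,v\}$ determined by $u\mapsto xy$, $v\mapsto x^2y$ is surjective, and its kernel is the Lie ideal of $\mathfrak{L}$ generated by $\{\alpha_n : n\geq 1\}$.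
   Context: The elements $x^ky^l$ ($k,l\geq 0$) form an $\mathbb{F}$-basis of $\mathscr{U}$, and $[x^ky,x^my]=(k-m)x^{k+m}y$, so $\mathscr{R}$ is closed under the bracket $[f,g]=fg-gf$. Words and order. Let $X=\{u,v\}$ with $v>u$. Words on $X$ are finite sequences of elements of $X$, multiplied by concatenation; $|w|$ is the length of $w$. For words $w=x_1\cdots x_k$, $w'=y_1\cdots y_h$, write $w>w'$ if there is a positive integer $i\leq\min\{k,h\}$ with $x_i>y_i$ and $x_j=y_j$ for all $j<i$. Write $w\vartriangleright w'$ if $ww'>w'w$. Regular words. A nonempty word $w$ is regular if for every factorization $w=ab$ into nonempty words $a,b$ one has $w\vartriangleright ba$. Elements of $X$ are regular. For a regular word $w$ with $|w|\geq 2$, let $d$ be the longest proper ending (proper nonempty suffix) of $w$ that is regular, and write $w=cd$; it is known that $c$ is then regular. This is the regular factoring of $w$. Bracketing. Let $\mathfrak{L}$ be the free Lie algebra over $\mathbb{F}$ on $X$. For $z\in X$ put $\llbracket z\rrbracket:=z\in\mathfrak{L}$, and for a regular word $w$ with $|w|\geq 2$ and regular factoring $w=cd$ put recursively $\llbracket w\rrbracket:=[\llbracket c\rrbracket,\llbracket d\rrbracket]\in\mathfrak{L}$. The words $vu^n$ ($n\geq 0$) and $vu^{n-1}vu^n$ ($n\geq 1$) are regular, so each $\alpha_n$ is a well-defined element of $\mathfrak{L}$. *)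

theory Defs
  imports Complex_Main
begin

section \<open>Lie algebras\<close>

locale lie_algebra = vector_space scale
  for scale :: "'k::field \<Rightarrow> 'a::ab_group_add \<Rightarrow> 'a" +
  fixes bracket :: "'a \<Rightarrow> 'a \<Rightarrow> 'a"
  assumes bracket_add_left: "bracket (a + b) c = bracket a c + bracket b c"
    and bracket_add_right: "bracket a (b + c) = bracket a b + bracket a c"
    and bracket_scale_left: "bracket (scale r a) b = scale r (bracket a b)"
    and bracket_scale_right: "bracket a (scale r b) = scale r (bracket a b)"
    and bracket_self: "bracket a a = 0"
    and jacobi: "bracket a (bracket b c) + bracket b (bracket c a) + bracket c (bracket a b) = 0"
begin

definition lie_subalgebra :: "'a set \<Rightarrow> bool" where
  "lie_subalgebra S \<longleftrightarrow> subspace S \<and> (\<forall>a\<in>S. \<forall>b\<in>S. bracket a b \<in> S)"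

definition lie_ideal :: "'a set \<Rightarrow> bool" where
  "lie_ideal I \<longleftrightarrow> subspace I \<and> (\<forall>a. \<forall>b\<in>I. bracket a b \<in> I)"

definition lie_ideal_generated :: "'a set \<Rightarrow> 'a set" where
  "lie_ideal_generated S = lie_ideal hull S"

end

definition lie_hom ::
  "('k::field \<Rightarrow> 'a::ab_group_add \<Rightarrow> 'a) \<Rightarrow> ('a \<Rightarrow> 'a \<Rightarrow> 'a) \<Rightarrow>
   ('k \<Rightarrow> 'b::ab_group_add \<Rightarrow> 'b) \<Rightarrow> ('b \<Rightarrow> 'b \<Rightarrow> 'b) \<Rightarrow> ('a \<Rightarrow> 'b) \<Rightarrow> bool" where
  "lie_hom s1 br1 s2 br2 f \<longleftrightarrow>
     lie_algebra s1 br1 \<and> lie_algebra s2 br2 \<and> Vector_Spaces.linear s1 s2 f \<and>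
     (\<forall>a b. f (br1 a b) = br2 (f a) (f b))"


section \<open>The free Lie algebra\<close>

text \<open>
  The free Lie algebra over a field \<open>'k\<close> on a set of generators \<open>'g\<close> is the set of formal
  expressions in the operations of a Lie algebra, modulo the least congruence that satisfies the
  Lie algebra axioms. Its universal property is proved below as \<open>free_lie_universal\<close>.
\<close>

datatype ('g, 'k) lie_term =
    LGen 'g
  | LZero
  | LAdd "('g, 'k) lie_term" "('g, 'k) lie_term"
  | LScale 'k "('g, 'k) lie_term"
  | LBracket "('g, 'k) lie_term" "('g, 'k) lie_term"

inductive lie_cong :: "('g, 'k::field) lie_term \<Rightarrow> ('g, 'k) lie_term \<Rightarrow> bool" where
  refl: "lie_cong a a"
| sym: "lie_cong a b \<Longrightarrow> lie_cong b a"
| trans: "lie_cong a b \<Longrightarrow> lie_cong b c \<Longrightarrow> lie_cong a c"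
| cong_add: "lie_cong a a' \<Longrightarrow> lie_cong b b' \<Longrightarrow> lie_cong (LAdd a b) (LAdd a' b')"
| cong_scale: "lie_cong a a' \<Longrightarrow> lie_cong (LScale r a) (LScale r a')"
| cong_bracket: "lie_cong a a' \<Longrightarrow> lie_cong b b' \<Longrightarrow> lie_cong (LBracket a b) (LBracket a' b')"
| add_assoc: "lie_cong (LAdd (LAdd a b) c) (LAdd a (LAdd b c))"
| add_commute: "lie_cong (LAdd a b) (LAdd b a)"
| add_zero: "lie_cong (LAdd LZero a) a"
| add_minus: "lie_cong (LAdd (LScale (-1) a) a) LZero"
| scale_add: "lie_cong (LScale r (LAdd a b)) (LAdd (LScale r a) (LScale r b))"
| add_scale: "lie_cong (LScale (r + s) a) (LAdd (LScale r a) (LScale s a))"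
| scale_scale: "lie_cong (LScale r (LScale s a)) (LScale (r * s) a)"
| scale_one: "lie_cong (LScale 1 a) a"
| bracket_add_left: "lie_cong (LBracket (LAdd a b) c) (LAdd (LBracket a c) (LBracket b c))"
| bracket_add_right: "lie_cong (LBracket a (LAdd b c)) (LAdd (LBracket a b) (LBracket a c))"
| bracket_scale_left: "lie_cong (LBracket (LScale r a) b) (LScale r (LBracket a b))"
| bracket_scale_right: "lie_cong (LBracket a (LScale r b)) (LScale r (LBracket a b))"
| bracket_self: "lie_cong (LBracket a a) LZero"
| jacobi: "lie_cong (LAdd (LAdd (LBracket a (LBracket b c)) (LBracket b (LBracket c a)))
                      (LBracket c (LBracket a b))) LZero"

quotient_type (overloaded) ('g, 'k) free_lie = "('g, 'k::field) lie_term" / lie_cong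
  by (rule equivpI)
     (auto intro: reflpI sympI transpI lie_cong.refl lie_cong.sym lie_cong.trans)

instantiation free_lie :: (type, field) ab_group_add
begin

lift_definition zero_free_lie :: "('a, 'b) free_lie" is LZero .
lift_definition plus_free_lie :: "('a, 'b) free_lie \<Rightarrow> ('a, 'b) free_lie \<Rightarrow> ('a, 'b) free_lie"
  is LAdd by (rule lie_cong.cong_add)
lift_definition uminus_free_lie :: "('a, 'b) free_lie \<Rightarrow> ('a, 'b) free_lie"
  is "LScale (-1)" by (rule lie_cong.cong_scale)
definition minus_free_lie :: "('a, 'b) free_lie \<Rightarrow> ('a, 'b) free_lie \<Rightarrow> ('a, 'b) free_lie"
  where "minus_free_lie a b = a + (- b)"

instance
proof
  fix a b c :: "('a, 'b) free_lie"
  show "a + b + c = a + (b + c)" by transfer (rule lie_cong.add_assoc)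
  show "a + b = b + a" by transfer (rule lie_cong.add_commute)
  show "0 + a = a" by transfer (rule lie_cong.add_zero)
  show "- a + a = 0" by transfer (rule lie_cong.add_minus)
  show "a - b = a + - b" by (rule minus_free_lie_def)
qed

end

lift_definition free_lie_gen :: "'g \<Rightarrow> ('g, 'k::field) free_lie" is LGen .

lift_definition free_lie_scale :: "'k::field \<Rightarrow> ('g, 'k) free_lie \<Rightarrow> ('g, 'k) free_lie"
  is LScale by (rule lie_cong.cong_scale)

lift_definition free_lie_bracket ::
  "('g, 'k::field) free_lie \<Rightarrow> ('g, 'k) free_lie \<Rightarrow> ('g, 'k) free_lie"
  is LBracket by (rule lie_cong.cong_bracket)

interpretation free_lie: lie_algebra free_lie_scale free_lie_bracket
proof
  fix r s :: 'a and a b c :: "('b, 'a) free_lie"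
  show "free_lie_scale r (a + b) = free_lie_scale r a + free_lie_scale r b"
    by transfer (rule lie_cong.scale_add)
  show "free_lie_scale (r + s) a = free_lie_scale r a + free_lie_scale s a"
    by transfer (rule lie_cong.add_scale)
  show "free_lie_scale r (free_lie_scale s a) = free_lie_scale (r * s) a"
    by transfer (rule lie_cong.scale_scale)
  show "free_lie_scale 1 a = a"
    by transfer (rule lie_cong.scale_one)
  show "free_lie_bracket (a + b) c = free_lie_bracket a c + free_lie_bracket b c"
    by transfer (rule lie_cong.bracket_add_left)
  show "free_lie_bracket a (b + c) = free_lie_bracket a b + free_lie_bracket a c"
    by transfer (rule lie_cong.bracket_add_right)
  show "free_lie_bracket (free_lie_scale r a) b = free_lie_scale r (free_lie_bracket a b)"
    by transfer (rule lie_cong.bracket_scale_left)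
  show "free_lie_bracket a (free_lie_scale r b) = free_lie_scale r (free_lie_bracket a b)"
    by transfer (rule lie_cong.bracket_scale_right)
  show "free_lie_bracket a a = 0"
    by transfer (rule lie_cong.bracket_self)
  show "free_lie_bracket a (free_lie_bracket b c) + free_lie_bracket b (free_lie_bracket c a)
          + free_lie_bracket c (free_lie_bracket a b) = 0"
    by transfer (rule lie_cong.jacobi)
qed

context lie_algebra
begin

primrec lie_term_eval :: "('g \<Rightarrow> 'a) \<Rightarrow> ('g, 'k) lie_term \<Rightarrow> 'a" where
  "lie_term_eval f (LGen g) = f g"
| "lie_term_eval f LZero = 0"
| "lie_term_eval f (LAdd a b) = lie_term_eval f a + lie_term_eval f b"
| "lie_term_eval f (LScale r a) = scale r (lie_term_eval f a)"
| "lie_term_eval f (LBracket a b) = bracket (lie_term_eval f a) (lie_term_eval f b)"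

lemma lie_term_eval_cong: "lie_cong a b \<Longrightarrow> lie_term_eval f a = lie_term_eval f b"
  by (induction rule: lie_cong.induct)
     (simp_all add: add_ac scale_right_distrib scale_left_distrib bracket_add_left
        bracket_add_right bracket_scale_left bracket_scale_right bracket_self
        jacobi[unfolded add.assoc])

lemma free_lie_universal:
  "\<exists>!\<phi>. lie_hom free_lie_scale free_lie_bracket scale bracket \<phi> \<and> (\<forall>g. \<phi> (free_lie_gen g) = f g)"
proof (rule ex_ex1I)
  define \<phi> where "\<phi> t = lie_term_eval f (rep_free_lie t)" for t
  have abs: "\<phi> (abs_free_lie t) = lie_term_eval f t" for t
    unfolding \<phi>_def
    by (intro lie_term_eval_cong) (meson Quotient_free_lie Quotient_rep_abs lie_cong.refl)
  have 1: "\<phi> (free_lie_gen g) = f g" for g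
    by (simp add: free_lie_gen.abs_eq abs)
  have 2: "\<phi> (a + b) = \<phi> a + \<phi> b" for a b
    by (induct a rule: free_lie.abs_induct, induct b rule: free_lie.abs_induct)
       (simp add: plus_free_lie.abs_eq abs)
  have 3: "\<phi> (free_lie_scale r a) = scale r (\<phi> a)" for r a
    by (induct a rule: free_lie.abs_induct) (simp add: free_lie_scale.abs_eq abs)
  have 4: "\<phi> (free_lie_bracket a b) = bracket (\<phi> a) (\<phi> b)" for a b
    by (induct a rule: free_lie.abs_induct, induct b rule: free_lie.abs_induct)
       (simp add: free_lie_bracket.abs_eq abs)
  have "Vector_Spaces.linear free_lie_scale scale \<phi>"
    by (intro Vector_Spaces.linear.intro module_hom.intro module_hom_axioms.intro 2 3
          free_lie.vector_space_axioms vector_space_axioms free_lie.module_axioms module_axioms)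
  then show "\<exists>\<phi>. lie_hom free_lie_scale free_lie_bracket scale bracket \<phi> \<and>
      (\<forall>g. \<phi> (free_lie_gen g) = f g)"
    unfolding lie_hom_def
    using 1 4 free_lie.lie_algebra_axioms lie_algebra_axioms by blast
next
  fix \<phi> \<psi>
  assume \<phi>: "lie_hom free_lie_scale free_lie_bracket scale bracket \<phi> \<and>
      (\<forall>g. \<phi> (free_lie_gen g) = f g)"
    and \<psi>: "lie_hom free_lie_scale free_lie_bracket scale bracket \<psi> \<and>
      (\<forall>g. \<psi> (free_lie_gen g) = f g)"
  have *: "h (abs_free_lie t) = lie_term_eval f t"
    if "lie_hom free_lie_scale free_lie_bracket scale bracket h \<and>
      (\<forall>g. h (free_lie_gen g) = f g)" for h t
  proof -
    have h: "Vector_Spaces.linear free_lie_scale scale h"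
      "\<And>a b. h (free_lie_bracket a b) = bracket (h a) (h b)"
      "\<And>g. h (free_lie_gen g) = f g"
      using that by (auto simp: lie_hom_def)
    interpret h: Vector_Spaces.linear free_lie_scale scale h by fact
    show ?thesis
    proof (induction t)
      case LZero
      show ?case using h.zero by (simp add: zero_free_lie_def)
    qed (simp_all flip: free_lie_gen.abs_eq plus_free_lie.abs_eq free_lie_scale.abs_eq
           free_lie_bracket.abs_eq add: h h.add h.scale)
  qed
  show "\<phi> = \<psi>"
  proof
    fix t show "\<phi> t = \<psi> t"
      by (induct t rule: free_lie.abs_induct) (simp add: *[OF \<phi>] *[OF \<psi>])
  qed
qed

end


section \<open>Regular words and their bracketing\<close>

text \<open>
  A proper prefix and the word it extends are incomparable in this order.
\<close>

definition word_gt :: "'g::linorder list \<Rightarrow> 'g list \<Rightarrow> bool" where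
  "word_gt w w' \<longleftrightarrow>
     (\<exists>i < min (length w) (length w'). w ! i > w' ! i \<and> (\<forall>j<i. w ! j = w' ! j))"

definition word_tri :: "'g::linorder list \<Rightarrow> 'g list \<Rightarrow> bool" where
  "word_tri w w' \<longleftrightarrow> word_gt (w @ w') (w' @ w)"

definition regular :: "'g::linorder list \<Rightarrow> bool" where
  "regular w \<longleftrightarrow> w \<noteq> [] \<and> (\<forall>a b. a \<noteq> [] \<longrightarrow> b \<noteq> [] \<longrightarrow> w = a @ b \<longrightarrow> word_tri w (b @ a))"

text \<open>
  The regular factoring of \<open>w\<close> is \<open>w = take i w @ drop i w\<close> for this \<open>i\<close>: the longest proper
  regular ending starts at the least positive position from which the word is regular.
\<close>

definition split_pos :: "'g::linorder list \<Rightarrow> nat" where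
  "split_pos w = (LEAST i. 0 < i \<and> i < length w \<and> regular (drop i w))"

lemma regular_singleton: "regular [z]"
  by (auto simp: regular_def Cons_eq_append_conv)

lemma split_pos:
  assumes "2 \<le> length w"
  shows "0 < split_pos w \<and> split_pos w < length w \<and> regular (drop (split_pos w) w)"
  unfolding split_pos_def
proof (rule LeastI)
  have "w \<noteq> []" using assms by auto
  then have "drop (length w - 1) w = [last w]"
    by (metis append_butlast_last_id append_eq_conv_conj length_butlast)
  then show "0 < length w - 1 \<and> length w - 1 < length w \<and> regular (drop (length w - 1) w)"
    using assms by (auto simp: regular_singleton)
qed

text \<open>
  Only the values at regular words are meaningful; other words of length at least two are sent
  to \<open>0\<close>, as is the empty word.
\<close>

function bracketing :: "'g::linorder list \<Rightarrow> ('g, 'k::field) free_lie" where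
  "bracketing w =
     (if length w = 1 then free_lie_gen (hd w)
      else if regular w then
        free_lie_bracket (bracketing (take (split_pos w) w)) (bracketing (drop (split_pos w) w))
      else 0)"
  by pat_completeness auto
termination
proof (relation "measure length")
  fix w :: "'g::linorder list"
  assume "length w \<noteq> 1" "regular w"
  then have "2 \<le> length w"
    by (cases w) (auto simp: regular_def Suc_le_eq)
  from split_pos[OF this]
  show "(take (split_pos w) w, w) \<in> measure length" "(drop (split_pos w) w, w) \<in> measure length"
    by auto
qed auto

declare bracketing.simps [simp del]

datatype letter = letter_u | letter_v

instantiation letter :: linorder
begin

definition less_letter :: "letter \<Rightarrow> letter \<Rightarrow> bool" where
  "a < b \<longleftrightarrow> a = letter_u \<and> b = letter_v"
definition less_eq_letter :: "letter \<Rightarrow> letter \<Rightarrow> bool" where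
  "a \<le> b \<longleftrightarrow> a = b \<or> a < (b :: letter)"

instance
  by standard (use letter.exhaust in \<open>auto simp: less_letter_def less_eq_letter_def\<close>)

end

definition alpha :: "nat \<Rightarrow> (letter, 'k::field_char_0) free_lie" where
  "alpha n =
     bracketing ([letter_v] @ replicate (n - 1) letter_u @ [letter_v] @ replicate n letter_u)
     + free_lie_scale (fact n * fact (n - 1) / fact (2 * n + 1))
         (bracketing ([letter_v] @ replicate (2 * n + 1) letter_u))"


section \<open>The associative algebra with generators x, y and relation xy - yx = x\<close>

text \<open>
  As for the free Lie algebra: formal expressions in the operations of a unital associative
  algebra over \<open>'k\<close>, modulo the least congruence that satisfies the axioms of unital associative
  algebras and the defining relation.
\<close>

datatype 'k U_term =
    UX
  | UY
  | UZero
  | UOne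
  | UAdd "'k U_term" "'k U_term"
  | UScale 'k "'k U_term"
  | UMult "'k U_term" "'k U_term"

inductive U_cong :: "'k::field U_term \<Rightarrow> 'k U_term \<Rightarrow> bool" where
  refl: "U_cong a a"
| sym: "U_cong a b \<Longrightarrow> U_cong b a"
| trans: "U_cong a b \<Longrightarrow> U_cong b c \<Longrightarrow> U_cong a c"
| cong_add: "U_cong a a' \<Longrightarrow> U_cong b b' \<Longrightarrow> U_cong (UAdd a b) (UAdd a' b')"
| cong_scale: "U_cong a a' \<Longrightarrow> U_cong (UScale r a) (UScale r a')"
| cong_mult: "U_cong a a' \<Longrightarrow> U_cong b b' \<Longrightarrow> U_cong (UMult a b) (UMult a' b')"
| add_assoc: "U_cong (UAdd (UAdd a b) c) (UAdd a (UAdd b c))"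
| add_commute: "U_cong (UAdd a b) (UAdd b a)"
| add_zero: "U_cong (UAdd UZero a) a"
| add_minus: "U_cong (UAdd (UScale (-1) a) a) UZero"
| scale_add: "U_cong (UScale r (UAdd a b)) (UAdd (UScale r a) (UScale r b))"
| add_scale: "U_cong (UScale (r + s) a) (UAdd (UScale r a) (UScale s a))"
| scale_scale: "U_cong (UScale r (UScale s a)) (UScale (r * s) a)"
| scale_one: "U_cong (UScale 1 a) a"
| mult_assoc: "U_cong (UMult (UMult a b) c) (UMult a (UMult b c))"
| one_mult: "U_cong (UMult UOne a) a"
| mult_one: "U_cong (UMult a UOne) a"
| mult_add_left: "U_cong (UMult (UAdd a b) c) (UAdd (UMult a c) (UMult b c))"
| mult_add_right: "U_cong (UMult a (UAdd b c)) (UAdd (UMult a b) (UMult a c))"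
| mult_scale_left: "U_cong (UMult (UScale r a) b) (UScale r (UMult a b))"
| mult_scale_right: "U_cong (UMult a (UScale r b)) (UScale r (UMult a b))"
| relation: "U_cong (UAdd (UMult UX UY) (UScale (-1) (UMult UY UX))) UX"

quotient_type (overloaded) 'k U_alg = "'k::field U_term" / U_cong
  by (rule equivpI) (auto intro: reflpI sympI transpI U_cong.refl U_cong.sym U_cong.trans)

primrec U_augmentation :: "'k::field U_term \<Rightarrow> 'k" where
  "U_augmentation UX = 0"
| "U_augmentation UY = 0"
| "U_augmentation UZero = 0"
| "U_augmentation UOne = 1"
| "U_augmentation (UAdd a b) = U_augmentation a + U_augmentation b"
| "U_augmentation (UScale r a) = r * U_augmentation a"
| "U_augmentation (UMult a b) = U_augmentation a * U_augmentation b"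

lemma U_augmentation_cong: "U_cong a b \<Longrightarrow> U_augmentation a = U_augmentation b"
  by (induction rule: U_cong.induct) (simp_all add: algebra_simps)

instantiation U_alg :: (field) ring_1
begin

lift_definition zero_U_alg :: "'a U_alg" is UZero .
lift_definition one_U_alg :: "'a U_alg" is UOne .
lift_definition plus_U_alg :: "'a U_alg \<Rightarrow> 'a U_alg \<Rightarrow> 'a U_alg"
  is UAdd by (rule U_cong.cong_add)
lift_definition times_U_alg :: "'a U_alg \<Rightarrow> 'a U_alg \<Rightarrow> 'a U_alg"
  is UMult by (rule U_cong.cong_mult)
lift_definition uminus_U_alg :: "'a U_alg \<Rightarrow> 'a U_alg"
  is "UScale (-1)" by (rule U_cong.cong_scale)
definition minus_U_alg :: "'a U_alg \<Rightarrow> 'a U_alg \<Rightarrow> 'a U_alg"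
  where "minus_U_alg a b = a + (- b)"

instance
proof
  fix a b c :: "'a U_alg"
  show "a + b + c = a + (b + c)" by transfer (rule U_cong.add_assoc)
  show "a + b = b + a" by transfer (rule U_cong.add_commute)
  show "0 + a = a" by transfer (rule U_cong.add_zero)
  show "- a + a = 0" by transfer (rule U_cong.add_minus)
  show "a - b = a + - b" by (rule minus_U_alg_def)
  show "a * b * c = a * (b * c)" by transfer (rule U_cong.mult_assoc)
  show "1 * a = a" by transfer (rule U_cong.one_mult)
  show "a * 1 = a" by transfer (rule U_cong.mult_one)
  show "(a + b) * c = a * c + b * c" by transfer (rule U_cong.mult_add_left)
  show "a * (b + c) = a * b + a * c" by transfer (rule U_cong.mult_add_right)
  show "(0 :: 'a U_alg) \<noteq> 1" by transfer (use U_augmentation_cong in fastforce)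
qed

end

lift_definition U_x :: "'k::field U_alg" is UX .
lift_definition U_y :: "'k::field U_alg" is UY .

lift_definition U_scale :: "'k::field \<Rightarrow> 'k U_alg \<Rightarrow> 'k U_alg"
  is UScale by (rule U_cong.cong_scale)

definition U_bracket :: "'k::field U_alg \<Rightarrow> 'k U_alg \<Rightarrow> 'k U_alg" where
  "U_bracket f g = f * g - g * f"

lemma U_scale_mult_left: "U_scale r a * b = U_scale r (a * b)"
  by transfer (rule U_cong.mult_scale_left)

lemma U_scale_mult_right: "a * U_scale r b = U_scale r (a * b)"
  by transfer (rule U_cong.mult_scale_right)

lemma U_relation: "U_x * U_y - U_y * U_x = (U_x :: 'k::field U_alg)"
  unfolding minus_U_alg_def by transfer (rule U_cong.relation)

interpretation U_alg: vector_space U_scale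
proof
  fix r s :: 'a and a b :: "'a U_alg"
  show "U_scale r (a + b) = U_scale r a + U_scale r b"
    by transfer (rule U_cong.scale_add)
  show "U_scale (r + s) a = U_scale r a + U_scale s a"
    by transfer (rule U_cong.add_scale)
  show "U_scale r (U_scale s a) = U_scale (r * s) a"
    by transfer (rule U_cong.scale_scale)
  show "U_scale 1 a = a"
    by transfer (rule U_cong.scale_one)
qed

interpretation U_alg: lie_algebra U_scale U_bracket
  by standard (simp_all add: U_bracket_def algebra_simps U_scale_mult_left U_scale_mult_right)

text \<open>Universal property of the presented algebra.\<close>

lemma U_universal:
  fixes scale :: "'k::field \<Rightarrow> 'a::ring_1 \<Rightarrow> 'a" and p q :: 'a
  assumes "vector_space scale"
    and scale_left: "\<And>r a b. scale r a * b = scale r (a * b)"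
    and scale_right: "\<And>r a b. a * scale r b = scale r (a * b)"
    and rel: "p * q - q * p = p"
  shows "\<exists>!\<phi>. Vector_Spaces.linear U_scale scale \<phi> \<and> \<phi> 1 = 1 \<and> (\<forall>a b. \<phi> (a * b) = \<phi> a * \<phi> b) \<and>
           \<phi> U_x = p \<and> \<phi> U_y = q"
    (is "\<exists>!\<phi>. ?P \<phi>")
proof -
  interpret vector_space scale by fact
  define ev where "ev = rec_U_term p q 0 1 (\<lambda>_ _. (+)) (\<lambda>r _. scale r) (\<lambda>_ _. (*))"
  have ev [simp]: "ev UX = p" "ev UY = q" "ev UZero = 0" "ev UOne = 1"
    "ev (UAdd a b) = ev a + ev b" "ev (UScale r a) = scale r (ev a)"
    "ev (UMult a b) = ev a * ev b" for a b r
    by (simp_all add: ev_def)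
  have ev_cong: "ev a = ev b" if "U_cong a b" for a b
    using that
  proof (induction rule: U_cong.induct)
    case relation
    show ?case using rel by simp
  qed (simp_all add: add_ac mult.assoc distrib_left distrib_right scale_right_distrib
         scale_left_distrib scale_left scale_right)
  define \<phi> where "\<phi> t = ev (rep_U_alg t)" for t
  have abs: "\<phi> (abs_U_alg t) = ev t" for t
    unfolding \<phi>_def by (intro ev_cong) (meson Quotient_U_alg Quotient_rep_abs U_cong.refl)
  have add: "\<phi> (a + b) = \<phi> a + \<phi> b" for a b
    by (induct a rule: U_alg.abs_induct, induct b rule: U_alg.abs_induct)
       (simp add: plus_U_alg.abs_eq abs)
  have sc: "\<phi> (U_scale r a) = scale r (\<phi> a)" for r a
    by (induct a rule: U_alg.abs_induct) (simp add: U_scale.abs_eq abs)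
  have mult: "\<phi> (a * b) = \<phi> a * \<phi> b" for a b
    by (induct a rule: U_alg.abs_induct, induct b rule: U_alg.abs_induct)
       (simp add: times_U_alg.abs_eq abs)
  have "Vector_Spaces.linear U_scale scale \<phi>"
    by (intro Vector_Spaces.linear.intro module_hom.intro module_hom_axioms.intro add sc
          U_alg.vector_space_axioms vector_space_axioms U_alg.module_axioms module_axioms)
  then have ex: "?P \<phi>"
    by (simp add: mult one_U_alg_def U_x_def U_y_def abs)
  have uniq: "h (abs_U_alg t) = ev t" if "?P h" for h t
  proof -
    have h: "Vector_Spaces.linear U_scale scale h" "h 1 = 1" "\<And>a b. h (a * b) = h a * h b"
      "h U_x = p" "h U_y = q"
      using that by auto
    interpret h: Vector_Spaces.linear U_scale scale h by fact
    show ?thesis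
    proof (induction t)
      case UZero
      show ?case using h.zero by (simp add: zero_U_alg_def)
    next
      case UOne
      show ?case using h(2) by (simp add: one_U_alg_def)
    next
      case UX
      show ?case using h(4) by (simp add: U_x_def)
    next
      case UY
      show ?case using h(5) by (simp add: U_y_def)
    qed (simp_all flip: plus_U_alg.abs_eq U_scale.abs_eq times_U_alg.abs_eq
           add: h(3) h.add h.scale)
  qed
  show ?thesis
  proof (rule ex1I[of ?P, OF ex])
    fix h assume h: "?P h"
    show "h = \<phi>"
    proof
      fix t show "h t = \<phi> t"
        by (induct t rule: U_alg.abs_induct) (simp add: uniq[OF h] abs)
    qed
  qed
qed

definition R_alg :: "'k::field U_alg set" where
  "R_alg = U_alg.span {U_x ^ k * U_y | k. 1 \<le> k}"

end

theory Submission
  imports Defs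
begin

text \<open>
  Put \<open>E\<^sub>1 = u\<close> and \<open>E\<^bsub>n+2\<^esub> = \<lbrakk>vu\<^sup>n\<rbrakk> / n!\<close>, so that \<open>[E\<^sub>k, E\<^sub>1] = (k - 1) E\<^bsub>k+1\<^esub>\<close> already in the free Lie
  algebra, while \<open>\<alpha>\<^sub>n\<close> is a nonzero multiple of \<open>[E\<^bsub>n+1\<^esub>, E\<^bsub>n+2\<^esub>] + E\<^bsub>2n+3\<^esub>\<close>. The defects
  \<open>f(k, m) = [E\<^sub>k, E\<^sub>m] - (k - m) E\<^bsub>k+m\<^esub>\<close> satisfy
  \<open>[f(k, m), E\<^sub>1] = (k - 1) f(k + 1, m) + (m - 1) f(k, m + 1)\<close>, so modulo the ideal of the \<open>\<alpha>\<^sub>n\<close>, where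
  \<open>f(m, m)\<close> and \<open>f(m, m + 1)\<close> vanish, all of them vanish by induction on \<open>m - k\<close>. Hence the \<open>E\<^sub>k\<close>
  span the quotient, and they are mapped to the elements \<open>x\<^sup>ky\<close>, which are linearly independent
  because \<open>U\<close> acts on sequences with \<open>x\<close> as the shift and \<open>y\<close> as multiplication by the index.
\<close>

section \<open>Lie algebras with Witt relations\<close>

context lie_algebra
begin

lemma bracket_zero_left [simp]: "bracket 0 a = 0"
  using bracket_add_left[of 0 0 a] by simp

lemma bracket_zero_right [simp]: "bracket a 0 = 0"
  using bracket_add_right[of a 0 0] by simp

lemma bracket_minus_left: "bracket (- a) b = - bracket a b"
  using bracket_add_left[of "- a" a b] by (simp add: eq_neg_iff_add_eq_0)

lemma bracket_minus_right: "bracket a (- b) = - bracket a b"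
  using bracket_add_right[of a "- b" b] by (simp add: eq_neg_iff_add_eq_0)

lemma bracket_diff_left: "bracket (a - b) c = bracket a c - bracket b c"
  using bracket_add_left[of a "- b" c] by (simp add: bracket_minus_left)

lemma bracket_commute: "bracket a b = - bracket b a"
proof -
  have "bracket a b + bracket b a = bracket (a + b) (a + b)"
    unfolding bracket_add_left bracket_add_right by (simp add: bracket_self)
  then show ?thesis by (simp add: bracket_self eq_neg_iff_add_eq_0)
qed

text \<open>The Jacobi identity in derivation form: bracketing with \<open>c\<close> on the right
  obeys the Leibniz rule. It is applied with \<open>c\<close> equal to \<open>e 1\<close>.\<close>

lemma bracket_bracket_left:
  "bracket (bracket a b) c = bracket (bracket a c) b + bracket a (bracket b c)"
proof -
  have "bracket b (bracket c a) = - bracket b (bracket a c)"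
    using bracket_commute[of c a] by (simp add: bracket_minus_right)
  also have "\<dots> = bracket (bracket a c) b"
    using bracket_commute[of b "bracket a c"] by simp
  finally show ?thesis
    using jacobi[of a b c] bracket_commute[of c "bracket a b"] by (simp add: algebra_simps)
qed

lemma lie_ideal_generated_ideal: "lie_ideal (lie_ideal_generated S)"
  unfolding lie_ideal_generated_def
proof (rule hull_in)
  fix T assume "\<forall>I\<in>T. lie_ideal I"
  then show "lie_ideal (\<Inter>T)"
    by (auto simp: lie_ideal_def intro!: subspace_Inter)
qed

lemma lie_ideal_generated_superset: "S \<subseteq> lie_ideal_generated S"
  unfolding lie_ideal_generated_def by (rule hull_subset)

lemma lie_ideal_generated_least: "S \<subseteq> I \<Longrightarrow> lie_ideal I \<Longrightarrow> lie_ideal_generated S \<subseteq> I"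
  unfolding lie_ideal_generated_def by (rule hull_minimal)

lemma lie_ideal_bracket_left: "lie_ideal I \<Longrightarrow> a \<in> I \<Longrightarrow> bracket a b \<in> I"
  using bracket_commute[of a b] unfolding lie_ideal_def by (metis subspace_neg)

lemma span_closed_bracket:
  assumes "\<And>a b. a \<in> S \<Longrightarrow> b \<in> S \<Longrightarrow> bracket a b \<in> span S"
    and "a \<in> span S" "b \<in> span S"
  shows "bracket a b \<in> span S"
  using \<open>a \<in> span S\<close>
proof (induction rule: span_induct_alt)
  case (step c a d)
  have "bracket a b \<in> span S"
    using \<open>b \<in> span S\<close>
  proof (induction rule: span_induct_alt)
    case (step c' b d')
    then show ?case using assms(1)[OF \<open>a \<in> S\<close>]
      by (simp add: bracket_add_right bracket_scale_right span_add span_scale)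
  qed (simp add: span_zero)
  then show ?case using step
    by (simp add: bracket_add_left bracket_scale_left span_add span_scale)
qed (simp add: span_zero)

end

text \<open>Membership in \<open>I\<close> replaces equality in a quotient Lie algebra.
  \<open>e_Suc\<close> is the relation between adjacent indices, since
  \<open>m - (m + 1) = -1\<close>; larger gaps are reached by bracketing with
  \<open>e 1\<close>.\<close>

lemma witt_relations:
  fixes scale :: "'k::field_char_0 \<Rightarrow> 'a::ab_group_add \<Rightarrow> 'a" and e :: "nat \<Rightarrow> 'a"
  assumes "lie_algebra scale bracket" and ideal: "lie_algebra.lie_ideal scale bracket I"
    and e_1: "\<And>k. 1 \<le> k \<Longrightarrow> bracket (e k) (e 1) = scale (of_nat k - 1) (e (Suc k))"
    and e_Suc: "\<And>m. 2 \<le> m \<Longrightarrow> bracket (e m) (e (Suc m)) + e (2 * m + 1) \<in> I"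
    and "1 \<le> k" "1 \<le> m"
  shows "bracket (e k) (e m) - scale (of_nat k - of_nat m) (e (k + m)) \<in> I"
proof -
  interpret lie_algebra scale bracket by fact
  have sub: "subspace I" using ideal by (simp add: lie_ideal_def)
  define f where
    "f k m = bracket (e k) (e m) - scale (of_nat k - of_nat m) (e (k + m))" for k m
  have f_swap: "f m k = - f k m" for k m
    unfolding f_def using bracket_commute[of "e m" "e k"]
    by (simp add: add.commute scale_left_diff_distrib)
  have deriv: "bracket (f k m) (e 1) =
      scale (of_nat k - 1) (f (Suc k) m) + scale (of_nat m - 1) (f k (Suc m))"
    if "1 \<le> k" "1 \<le> m" for k m
  proof -
    \<comment> \<open>The Leibniz rule matches the brackets on both sides; this identity between the
      coefficients of \<open>e (k + m + 1)\<close> is what remains.\<close>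
    have "scale ((of_nat k - of_nat m) * (of_nat (k + m) - 1)) (e (Suc (k + m))) =
        scale ((of_nat k - 1) * (of_nat (Suc k) - of_nat m)) (e (Suc (k + m)))
        + scale ((of_nat m - 1) * (of_nat k - of_nat (Suc m))) (e (Suc (k + m)))"
      unfolding scale_left_distrib[symmetric] by (simp add: algebra_simps)
    then show ?thesis
      using that unfolding f_def
      by (simp add: bracket_diff_left bracket_scale_left bracket_bracket_left[of _ _ "e 1"] e_1
          e_1[of "k + m", simplified] bracket_scale_right scale_right_diff_distrib
          flip: One_nat_def)
  qed
  have diag: "f m m \<in> I" for m
    by (simp add: f_def bracket_self subspace_0 sub)
  \<comment> \<open>\<open>e_Suc\<close> starts at 2; for \<open>m = 1\<close> the defect is already
    zero by \<open>e_1\<close>.\<close>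
  have near: "f m (Suc m) \<in> I" if "1 \<le> m" for m
  proof (cases "m = 1")
    case True
    have "bracket (e (Suc 1)) (e 1) = e (Suc (Suc 1))" using e_1[of 2] by (simp add: numeral_2_eq_2)
    then have "f (Suc 1) 1 = 0" by (simp add: f_def)
    then show ?thesis using True f_swap[of 1 "Suc 1"] subspace_0[OF sub] by simp
  next
    case False
    then show ?thesis
      using that e_Suc[of m] by (simp add: f_def mult_2)
  qed
  \<comment> \<open>Two consecutive gaps are carried together, with \<open>m\<close> arbitrary:
    \<open>deriv\<close> at \<open>(m, m + d + 1)\<close> yields gap \<open>d + 2\<close> at
    \<open>m\<close> from a bracket in \<open>I\<close> and gap \<open>d\<close> at
    \<open>m + 1\<close>.\<close>
  have above: "f m (m + d) \<in> I \<and> f m (m + Suc d) \<in> I" if "1 \<le> m" for m d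
    using that
  proof (induction d arbitrary: m)
    case 0
    then show ?case using diag near by simp
  next
    case (Suc d)
    have "f (Suc m) (m + Suc d) \<in> I"
      using Suc.IH[of "Suc m"] by simp
    then have "scale (of_nat m - 1) (f (Suc m) (m + Suc d)) \<in> I"
      by (rule subspace_scale[OF sub])
    moreover have "bracket (f m (m + Suc d)) (e 1) \<in> I"
      using Suc ideal by (blast intro: lie_ideal_bracket_left)
    ultimately have "scale (of_nat (m + Suc d) - 1) (f m (m + Suc (Suc d))) \<in> I"
      using deriv[of m "m + Suc d"] Suc.prems subspace_diff[OF sub] 
      by (metis (no_types, lifting) add_Suc_right add_diff_cancel_left' le_add1 le_trans)
    \<comment> \<open>This coefficient can be inverted because \<open>m\<close> is positive and the
      characteristic is zero.\<close>
    moreover have "of_nat (m + Suc d) - 1 = (of_nat (m + d) :: 'k)" "of_nat (m + d) \<noteq> (0::'k)"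
      using Suc.prems by (simp, simp del: of_nat_add)
    ultimately show ?case
      using subspace_scale[OF sub, of _ "inverse (of_nat (m + d))"] Suc by fastforce
  qed
  consider d where "m = k + d" | d where "k = m + d"
    by (metis nat_le_linear le_Suc_ex)
  then have "f k m \<in> I"
  proof cases
    case 2
    then show ?thesis
      using above[OF \<open>1 \<le> m\<close>, of d] f_swap[of k m] subspace_neg[OF sub] by metis
  qed (use above \<open>1 \<le> k\<close> in auto)
  then show ?thesis by (simp add: f_def)
qed

section \<open>The regular words\<close>

text \<open>The recursive form of the order lets simplification compare explicit words up to their
  first difference.\<close>

lemma word_gt_Cons [simp]:
  "word_gt (x # xs) (y # ys) \<longleftrightarrow> y < x \<or> x = y \<and> word_gt xs ys"
proof
  assume "word_gt (x # xs) (y # ys)"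
  then obtain i where i: "i < Suc (min (length xs) (length ys))" "(x # xs) ! i > (y # ys) ! i"
    and eq: "\<And>j. j < i \<Longrightarrow> (x # xs) ! j = (y # ys) ! j"
    by (auto simp: word_gt_def)
  show "y < x \<or> x = y \<and> word_gt xs ys"
  proof (cases i)
    case 0
    then show ?thesis using i by simp
  next
    case (Suc i')
    then show ?thesis
      using i eq[of 0] eq[of "Suc _"] by (auto simp: word_gt_def intro!: exI[of _ i'])
  qed
next
  assume "y < x \<or> x = y \<and> word_gt xs ys"
  then show "word_gt (x # xs) (y # ys)"
  proof
    assume "x = y \<and> word_gt xs ys"
    then obtain i where "i < min (length xs) (length ys)" "xs ! i > ys ! i"
      "\<And>j. j < i \<Longrightarrow> xs ! j = ys ! j" "x = y"
      by (auto simp: word_gt_def)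
    then show ?thesis
      unfolding word_gt_def by (intro exI[of _ "Suc i"]) (auto simp: nth_Cons split: nat.split)
  qed (auto simp: word_gt_def)
qed

lemma word_gt_append [simp]: "word_gt (p @ w) (p @ w') \<longleftrightarrow> word_gt w w'"
  by (induction p) auto

lemma word_gt_irrefl [simp]: "\<not> word_gt w w"
  by (auto simp: word_gt_def)

text \<open>A constant word equals its rotations, and no word exceeds itself.\<close>

lemma not_regular_replicate:
  assumes "2 \<le> m"
  shows "\<not> regular (replicate m z)"
proof
  assume "regular (replicate m z)"
  moreover have m: "replicate m z = [z] @ replicate (m - 1) z"
    "replicate (m - 1) z @ [z] = replicate m z"
    using assms by (cases m; simp add: replicate_append_same)+
  moreover have "replicate (m - 1) z \<noteq> []" using assms by simp
  ultimately have "word_tri (replicate m z) (replicate (m - 1) z @ [z])"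
    unfolding regular_def by blast
  then show False by (simp only: m(2) word_tri_def word_gt_irrefl)
qed

lemma append_eq_Cons_replicate:
  assumes "x # replicate n z = a @ b" "a \<noteq> []" "b \<noteq> []"
  obtains j where "b = z # replicate j z"
proof -
  have "\<forall>y\<in>set b. y = z" using assms by (cases a) (auto dest!: arg_cong[of _ _ set])
  then show ?thesis
    using assms(3) that[of "length b - 1"] replicate_length_same[of b z]
    by (cases b) (auto intro: that)
qed

lemma regular_vu: "regular (letter_v # replicate n letter_u)"
  unfolding regular_def
proof (intro conjI allI impI)
  fix a b assume "a \<noteq> []" "b \<noteq> []" "letter_v # replicate n letter_u = a @ b"
  then obtain j where "b = letter_u # replicate j letter_u"
    by (metis append_eq_Cons_replicate)
  then show "word_tri (letter_v # replicate n letter_u) (b @ a)"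
    by (simp add: word_tri_def less_letter_def)
qed simp

text \<open>The regular factoring splits off only the last \<open>u\<close>: every longer proper
  ending is a power of \<open>u\<close>, hence not regular.\<close>

lemma bracketing_vu:
  "bracketing (letter_v # replicate (Suc n) letter_u) =
     free_lie_bracket (bracketing (letter_v # replicate n letter_u)) (free_lie_gen letter_u)"
proof -
  let ?w = "letter_v # replicate (Suc n) letter_u"
  have drop: "drop i ?w = replicate (n + 2 - i) letter_u" if "0 < i" for i
    using that by (cases i) (simp_all del: replicate_Suc)
  have "split_pos ?w = Suc n"
    unfolding split_pos_def
  proof (rule Least_equality)
    show "0 < Suc n \<and> Suc n < length ?w \<and> regular (drop (Suc n) ?w)"
      using regular_singleton[of letter_u] drop[of "Suc n"] by simp
    fix i assume i: "0 < i \<and> i < length ?w \<and> regular (drop i ?w)"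
    then have "\<not> 2 \<le> n + 2 - i"
      using drop[of i] not_regular_replicate[of "n + 2 - i"] by metis
    then show "Suc n \<le> i" by simp
  qed
  moreover have "take n (replicate (Suc n) letter_u) = replicate n letter_u"
    by (simp only: take_replicate) simp
  ultimately show ?thesis
    using regular_vu[of "Suc n"] drop[of "Suc n"]
    by (subst bracketing.simps)
      (simp add: bracketing.simps[of "[letter_u]"] replicate_Suc[of 0] del: replicate_Suc)
qed

text \<open>A rotation starting with \<open>u\<close> loses at the first letter. The only other one,
  starting at the second \<open>v\<close>, has \<open>u\<close> where the word has that
  \<open>v\<close>.\<close>

lemma regular_vuvu:
  "regular (letter_v # replicate n letter_u @ letter_v # replicate (Suc n) letter_u)"
    (is "regular ?w")
  unfolding regular_def
proof (intro conjI allI impI)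
  fix a b assume ab: "a \<noteq> []" "b \<noteq> []" "?w = a @ b"
  then obtain z b' where b: "b = z # b'" by (cases b) auto
  show "word_tri ?w (b @ a)"
  proof (cases z)
    case letter_u
    then show ?thesis using b by (simp add: word_tri_def less_letter_def)
  next
    case letter_v
    obtain a' where a: "a = letter_v # a'" using ab by (cases a) auto
    have *: "replicate n letter_u @ letter_v # replicate (Suc n) letter_u = a' @ letter_v # b'"
      using ab a b letter_v by simp
    \<comment> \<open>Past its first letter the word contains a single \<open>v\<close>, so
      \<open>b\<close> must start there.\<close>
    have "replicate n letter_u = a' \<and> replicate (Suc n) letter_u = b'"
      using * by (subst (asm) append_Cons_eq_iff) auto
    then show ?thesis
      using a b letter_v
      by (auto simp: word_tri_def less_letter_def replicate_append_same[symmetric])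
  qed
qed simp

text \<open>The factoring cuts at the second \<open>v\<close>: an ending that starts earlier begins
  with \<open>u\<close> but contains \<open>v\<close>, so rotating that \<open>v\<close> to the
  front beats it.\<close>

lemma bracketing_vuvu:
  "bracketing (letter_v # replicate n letter_u @ letter_v # replicate (Suc n) letter_u) =
     free_lie_bracket (bracketing (letter_v # replicate n letter_u))
       (bracketing (letter_v # replicate (Suc n) letter_u))"
proof -
  let ?w = "letter_v # replicate n letter_u @ letter_v # replicate (Suc n) letter_u"
  have drop_Suc: "drop (Suc n) ?w = letter_v # replicate (Suc n) letter_u" by simp
  have "split_pos ?w = Suc n"
    unfolding split_pos_def
  proof (rule Least_equality)
    show "0 < Suc n \<and> Suc n < length ?w \<and> regular (drop (Suc n) ?w)"
      unfolding drop_Suc using regular_vu[of "Suc n"] by simp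
    fix i assume i: "0 < i \<and> i < length ?w \<and> regular (drop i ?w)"
    show "Suc n \<le> i"
    proof (rule ccontr)
      assume "\<not> Suc n \<le> i"
      then obtain j where j: "n + 1 - i = Suc j" by (cases "n + 1 - i") auto
      have "drop i ?w = replicate (n + 1 - i) letter_u @ letter_v # replicate (Suc n) letter_u"
        using i j by (cases i) auto
      then have w: "drop i ?w = (letter_u # replicate j letter_u) @ letter_v # replicate (Suc n) letter_u"
        using j by simp
      then have "word_tri (drop i ?w)
          ((letter_v # replicate (Suc n) letter_u) @ letter_u # replicate j letter_u)"
        using i unfolding regular_def by blast
      then show False
        unfolding w by (simp add: word_tri_def less_letter_def)
    qed
  qed
  moreover have "take (Suc n) ?w = letter_v # replicate n letter_u" by simp
  ultimately show ?thesis
    using regular_vuvu[of n] drop_Suc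
    by (subst bracketing.simps) (simp del: replicate_Suc take_Suc_Cons drop_Suc_Cons)
qed

section \<open>Witt generators of the free Lie algebra\<close>

text \<open>The value at \<open>0\<close> is junk.\<close>

definition witt_gen :: "nat \<Rightarrow> (letter, 'k::field_char_0) free_lie" where
  "witt_gen k =
     (if k = 1 then free_lie_gen letter_u
      else free_lie_scale (1 / fact (k - 2)) (bracketing (letter_v # replicate (k - 2) letter_u)))"

lemma witt_gen_1: "witt_gen 1 = free_lie_gen letter_u"
  by (simp add: witt_gen_def)

lemma witt_gen_2: "witt_gen 2 = free_lie_gen letter_v"
  by (simp add: witt_gen_def bracketing.simps[of "[letter_v]"])

text \<open>The factorials in \<open>witt_gen\<close> are chosen for this: appending
  \<open>u\<close> to the word replaces \<open>1/n!\<close> by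
  \<open>(n + 1)/(n + 1)!\<close>.\<close>

lemma bracket_witt_gen_1:
  assumes "1 \<le> k"
  shows "free_lie_bracket (witt_gen k) (witt_gen 1) =
    free_lie_scale (of_nat k - 1) (witt_gen (Suc k))"
proof (cases "k = 1")
  case True
  then show ?thesis by (simp add: free_lie.bracket_self)
next
  case False
  then have "2 \<le> k" using assms by simp
  then obtain n where "k = n + 2" by (metis le_Suc_ex add.commute)
  moreover have "(of_nat n + 1) * (1 / fact (Suc n)) = (1 :: 'a) / fact n"
    using of_nat_neq_0[of n, where 'a='a] unfolding fact_Suc by (simp add: add.commute)
  ultimately show ?thesis
    by (simp add: witt_gen_def free_lie.bracket_scale_left bracketing_vu add.commute
        del: replicate_Suc fact_Suc)
qed

text \<open>The normalising factors of the three generators clear the coefficient in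
  \<open>alpha n\<close>. As \<open>1 <= n\<close>, the index \<open>n + 1\<close> is not 1, so
  \<open>witt_gen (n + 1)\<close> comes from a word starting with \<open>v\<close>.\<close>

lemma alpha_witt_gen:
  assumes "1 \<le> n"
  shows "alpha n = free_lie_scale (fact n * fact (n - 1))
    (free_lie_bracket (witt_gen (n + 1)) (witt_gen (n + 2)) + witt_gen (2 * n + 3))"
proof -
  obtain m where n: "n = Suc m" using assms by (cases n) auto
  have "2 * n + 3 = Suc (Suc (2 * n + 1))" by simp
  then have *: "witt_gen (2 * n + 3) =
      free_lie_scale (1 / fact (2 * n + 1)) (bracketing (letter_v # replicate (2 * n + 1) letter_u))"
    by (simp add: witt_gen_def del: replicate_Suc)
  show ?thesis
    unfolding * alpha_def unfolding n using bracketing_vuvu[of m]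
    by (simp add: witt_gen_def free_lie.bracket_scale_left free_lie.bracket_scale_right
        free_lie.scale_right_distrib del: replicate_Suc fact_Suc)
qed

section \<open>Spanning modulo the ideal of the \<open>alpha n\<close>\<close>

lemma free_lie_induct [case_names gen zero add scale bracket]:
  assumes "\<And>g. P (free_lie_gen g)" "P 0" "\<And>a b. P a \<Longrightarrow> P b \<Longrightarrow> P (a + b)"
    "\<And>r a. P a \<Longrightarrow> P (free_lie_scale r a)"
    "\<And>a b. P a \<Longrightarrow> P b \<Longrightarrow> P (free_lie_bracket a b)"
  shows "P a"
proof (induct a rule: free_lie.abs_induct)
  case (1 t)
  show ?case
    by (induction t)
      (simp_all add: assms flip: free_lie_gen.abs_eq zero_free_lie_def plus_free_lie.abs_eq
        free_lie_scale.abs_eq free_lie_bracket.abs_eq)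
qed

text \<open>The span of the Witt generators together with \<open>I\<close> contains \<open>u\<close>
  and \<open>v\<close> and is closed under brackets by \<open>witt_relations\<close>, so it is
  everything.\<close>

lemma free_lie_spanning:
  fixes a :: "(letter, 'k::field_char_0) free_lie"
  defines "I \<equiv> free_lie.lie_ideal_generated {alpha n | n. 1 \<le> n}"
  obtains s where "s \<in> free_lie.span (witt_gen ` {1..})" "a - s \<in> I"
proof -
  have ideal: "free_lie.lie_ideal I"
    unfolding I_def by (rule free_lie.lie_ideal_generated_ideal)
  then have sub: "free_lie.subspace I" by (simp add: free_lie.lie_ideal_def)
  have e_Suc: "free_lie_bracket (witt_gen m) (witt_gen (Suc m)) + witt_gen (2 * m + 1) \<in> I"
    if "2 \<le> m" for m
  proof -
    define n where "n = m - 1"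
    have n: "m = n + 1" "1 \<le> n" using that by (auto simp: n_def)
    have "alpha n \<in> I"
      unfolding I_def
      by (rule subsetD[OF free_lie.lie_ideal_generated_superset]) (use n(2) in blast)
    then have "free_lie_scale (inverse (fact n * fact (n - 1))) (alpha n) \<in> I"
      by (rule free_lie.subspace_scale[OF sub])
    then have "free_lie_bracket (witt_gen (n + 1)) (witt_gen (n + 2)) + witt_gen (2 * n + 3) \<in> I"
      by (simp add: alpha_witt_gen[OF n(2)] field_simps)
    moreover have "Suc m = n + 2" "2 * m + 1 = 2 * n + 3" using n(1) by simp_all
    ultimately show ?thesis by (simp only: n(1))
  qed
  let ?G = "witt_gen ` {1..} \<union> I"
  have rel: "free_lie_bracket (witt_gen k) (witt_gen m) \<in> free_lie.span ?G"
    if "1 \<le> k" "1 \<le> m" for k m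
  proof -
    have "free_lie_bracket (witt_gen k) (witt_gen m)
        - free_lie_scale (of_nat k - of_nat m) (witt_gen (k + m)) \<in> I"
      by (intro witt_relations free_lie.lie_algebra_axioms ideal bracket_witt_gen_1 e_Suc that)
    moreover have "free_lie_scale (of_nat k - of_nat m) (witt_gen (k + m)) \<in> free_lie.span ?G"
      using that by (intro free_lie.span_scale free_lie.span_base) auto
    ultimately show ?thesis
      by (metis UnI2 diff_add_cancel free_lie.span_add free_lie.span_base)
  qed
  have "a \<in> free_lie.span ?G"
  proof (induction a rule: free_lie_induct)
    case (gen g)
    have "free_lie_gen g \<in> witt_gen ` {1..}"
    proof (cases g)
      case letter_u
      show ?thesis unfolding letter_u witt_gen_1[symmetric] by (rule imageI) simp
    next
      case letter_v
      show ?thesis unfolding letter_v witt_gen_2[symmetric] by (rule imageI) simp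
    qed
    then show ?case by (intro free_lie.span_base) auto
  next
    case (bracket a b)
    show ?case
    proof (rule free_lie.span_closed_bracket[OF _ bracket])
      fix a b assume "a \<in> ?G" "b \<in> ?G"
      moreover have "free_lie_bracket a b \<in> I" if "a \<in> I \<or> b \<in> I"
        using that ideal free_lie.lie_ideal_bracket_left free_lie.lie_ideal_def by blast
      ultimately show "free_lie_bracket a b \<in> free_lie.span ?G"
        using rel by (auto intro: free_lie.span_base)
    qed
  qed (auto intro: free_lie.span_add free_lie.span_scale free_lie.span_zero)
  \<comment> \<open>The span of a union is the sum of the spans, and \<open>I\<close> is its own
    span.\<close>
  then obtain s i where "s \<in> free_lie.span (witt_gen ` {1..})" "i \<in> I" "a = s + i"
    using free_lie.span_eq_iff[THEN iffD2, OF sub] by (auto simp: free_lie.span_Un)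
  then show ?thesis by (intro that[of s]) auto
qed

section \<open>The monomials \<open>x\<^sup>ky\<close>\<close>

abbreviation (input) e_mon :: "nat \<Rightarrow> 'k::field U_alg" where
  "e_mon k \<equiv> U_x ^ k * U_y"

lemma U_y_x_power: "U_y * U_x ^ m = U_x ^ m * U_y - U_scale (of_nat m) (U_x ^ m)"
proof (induction m)
  case (Suc m)
  have "U_y * U_x ^ Suc m = (U_x * U_y - U_x) * (U_x ^ m :: 'a U_alg)"
    using U_relation[where 'k='a] by (simp add: algebra_simps flip: mult.assoc)
  also have "\<dots> = U_x * (U_y * U_x ^ m) - U_x * U_x ^ m"
    by (simp add: algebra_simps)
  also have "\<dots> = U_x ^ Suc m * U_y - U_scale (of_nat (Suc m)) (U_x ^ Suc m)"
    unfolding Suc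
    by (simp add: algebra_simps U_scale_mult_right U_alg.scale_left_distrib)
  finally show ?case .
qed simp

text \<open>Moving \<open>y\<close> past \<open>x^m\<close> leaves the term
  \<open>x^(k+m) y^2\<close>, which is symmetric in \<open>k\<close> and \<open>m\<close> and
  cancels in the commutator.\<close>

lemma e_mon_bracket:
  "U_bracket (e_mon k) (e_mon m) = U_scale (of_nat k - of_nat m) (e_mon (k + m))"
proof -
  have *: "e_mon k * e_mon m = (U_x ^ (k + m) * U_y * U_y :: 'a U_alg) - U_scale (of_nat m) (e_mon (k + m))"
    for k m
  proof -
    have "e_mon k * e_mon m = U_x ^ k * (U_y * U_x ^ m) * (U_y :: 'a U_alg)"
      by (simp add: mult.assoc)
    also have "\<dots> = U_x ^ (k + m) * U_y * U_y - U_scale (of_nat m) (e_mon (k + m))"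
      unfolding U_y_x_power
      by (simp add: algebra_simps U_scale_mult_right U_scale_mult_left power_add)
    finally show ?thesis .
  qed
  show ?thesis
    unfolding U_bracket_def * by (simp add: U_alg.scale_left_diff_distrib add.commute)
qed

text \<open>The relation holds for this action: at index \<open>i\<close>, \<open>xy\<close> gives
  \<open>(i + 1) g (i + 1)\<close> and \<open>yx\<close> gives \<open>i g (i + 1)\<close>, with
  difference \<open>g (i + 1)\<close>.\<close>

primrec U_term_act :: "'k::field U_term \<Rightarrow> (nat \<Rightarrow> 'k) \<Rightarrow> nat \<Rightarrow> 'k" where
  "U_term_act UX = (\<lambda>g i. g (Suc i))"
| "U_term_act UY = (\<lambda>g i. of_nat i * g i)"
| "U_term_act UZero = (\<lambda>g i. 0)"
| "U_term_act UOne = (\<lambda>g. g)"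
| "U_term_act (UAdd a b) = (\<lambda>g i. U_term_act a g i + U_term_act b g i)"
| "U_term_act (UScale r a) = (\<lambda>g i. r * U_term_act a g i)"
| "U_term_act (UMult a b) = (\<lambda>g. U_term_act a (U_term_act b g))"

text \<open>Linearity in the sequence is what the axioms with a sum or a scalar in the right factor
  require.\<close>

lemma U_term_act_add:
  "U_term_act t (\<lambda>i. g i + h i) = (\<lambda>i. U_term_act t g i + U_term_act t h i)"
  by (induction t arbitrary: g h) (simp_all add: algebra_simps)

lemma U_term_act_scale: "U_term_act t (\<lambda>i. r * g i) = (\<lambda>i. r * U_term_act t g i)"
  by (induction t arbitrary: g) (simp_all add: algebra_simps)

lift_definition U_act :: "'k::field U_alg \<Rightarrow> (nat \<Rightarrow> 'k) \<Rightarrow> nat \<Rightarrow> 'k" is U_term_act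
proof -
  fix a b :: "'k U_term" assume "U_cong a b"
  then show "U_term_act a = U_term_act b"
  proof (induction rule: U_cong.induct)
    case (cong_mult a a' b b')
    then show ?case by simp
  qed (simp_all add: fun_eq_iff U_term_act_add U_term_act_scale algebra_simps)
qed

lemma U_act_mult: "U_act (a * b) g = U_act a (U_act b g)"
  by transfer simp

lemma U_act_x_power: "U_act (U_x ^ k) g i = g (i + k)"
proof (induction k arbitrary: g i)
  case 0
  have "U_act 1 g = g" by transfer simp
  then show ?case by simp
next
  case (Suc k)
  have "U_act U_x g i = g (Suc i)" for g :: "nat \<Rightarrow> 'a" and i by transfer simp
  then show ?case by (simp add: U_act_mult Suc)
qed

text \<open>The functional dual to \<open>x^k y\<close>: applied to the indicator of
  \<open>k\<close>, \<open>x^j y\<close> has value \<open>k\<close> at index 0 if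
  \<open>j = k\<close>, and 0 otherwise. For \<open>k = 0\<close> the division gives 0.\<close>

definition e_coeff :: "nat \<Rightarrow> 'k::field U_alg \<Rightarrow> 'k" where
  "e_coeff k a = U_act a (\<lambda>i. if i = k then 1 else 0) 0 / of_nat k"

lemma e_coeff_add: "e_coeff k (a + b) = e_coeff k a + e_coeff k b"
  unfolding e_coeff_def add_divide_distrib[symmetric] by transfer simp

lemma e_coeff_scale: "e_coeff k (U_scale r a) = r * e_coeff k a"
proof -
  have "U_act (U_scale r a) g i = r * U_act a g i" for g i by transfer simp
  then show ?thesis by (simp add: e_coeff_def)
qed

lemma e_coeff_0 [simp]: "e_coeff k 0 = 0"
  using e_coeff_scale[of k 0 0] by simp

lemma e_coeff_e_mon:
  assumes "1 \<le> k"
  shows "e_coeff k (e_mon j :: 'k::field_char_0 U_alg) = (if j = k then 1 else 0)"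
proof -
  have "U_act U_y g i = of_nat i * g i" for g :: "nat \<Rightarrow> 'k" and i by transfer simp
  then show ?thesis using assms by (simp add: e_coeff_def U_act_mult U_act_x_power)
qed

section \<open>The presentation\<close>

theorem theorem4p4:
  shows "U_alg.lie_subalgebra (R_alg :: 'k::field_char_0 U_alg set) \<and>
    (\<exists>!\<phi> :: (letter, 'k) free_lie \<Rightarrow> 'k U_alg.
       lie_hom free_lie_scale free_lie_bracket U_scale U_bracket \<phi> \<and>
       \<phi> (free_lie_gen letter_u) = U_x * U_y \<and>
       \<phi> (free_lie_gen letter_v) = U_x ^ 2 * U_y) \<and>
    (\<forall>\<phi> :: (letter, 'k) free_lie \<Rightarrow> 'k U_alg.
       lie_hom free_lie_scale free_lie_bracket U_scale U_bracket \<phi> \<and>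
       \<phi> (free_lie_gen letter_u) = U_x * U_y \<and>
       \<phi> (free_lie_gen letter_v) = U_x ^ 2 * U_y \<longrightarrow>
       range \<phi> = R_alg \<and>
       {a. \<phi> a = 0} = free_lie.lie_ideal_generated {alpha n | n. 1 \<le> n})"
proof (intro conjI allI impI; (elim conjE)?)
  have R_alg: "R_alg = U_alg.span (e_mon ` {1..} :: 'k U_alg set)"
    unfolding R_alg_def by (rule arg_cong[where f = U_alg.span]) auto
  have e_mon_R: "e_mon k \<in> (R_alg :: 'k U_alg set)" if "1 \<le> k" for k
    unfolding R_alg by (rule U_alg.span_base) (use that in blast)
  have "U_bracket a b \<in> R_alg" if "a \<in> R_alg" "b \<in> R_alg" for a b :: "'k U_alg"
    using that unfolding R_alg
  proof (rule U_alg.span_closed_bracket[rotated])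
    fix a b :: "'k U_alg"
    assume "a \<in> e_mon ` {1..}" "b \<in> e_mon ` {1..}"
    then obtain k m where "1 \<le> k" "a = e_mon k" "b = e_mon m" by auto
    then show "U_bracket a b \<in> U_alg.span (e_mon ` {1..})"
      using e_mon_R[of "k + m"] unfolding R_alg
      by (simp only: e_mon_bracket U_alg.span_scale trans_le_add1)
  qed
  then show "U_alg.lie_subalgebra (R_alg :: 'k U_alg set)"
    by (auto simp: U_alg.lie_subalgebra_def R_alg)
  have all_letter: "(\<forall>g. P g) \<longleftrightarrow> P letter_u \<and> P letter_v" for P
    by (metis letter.exhaust)
  \<comment> \<open>The two prescribed images form one function on letters, as the universal
    property expects.\<close>
  have gens: "(\<forall>g. \<phi> (free_lie_gen g) = case_letter (U_x * U_y) (U_x ^ 2 * U_y) g) \<longleftrightarrow>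
      \<phi> (free_lie_gen letter_u) = U_x * U_y \<and> \<phi> (free_lie_gen letter_v) = U_x ^ 2 * U_y"
    for \<phi> :: "(letter, 'k) free_lie \<Rightarrow> 'k U_alg"
    by (simp add: all_letter)
  show "\<exists>!\<phi> :: (letter, 'k) free_lie \<Rightarrow> 'k U_alg.
       lie_hom free_lie_scale free_lie_bracket U_scale U_bracket \<phi> \<and>
       \<phi> (free_lie_gen letter_u) = U_x * U_y \<and>
       \<phi> (free_lie_gen letter_v) = U_x ^ 2 * U_y"
    using U_alg.free_lie_universal[of "case_letter (U_x * U_y) (U_x ^ 2 * U_y) :: letter \<Rightarrow> 'k U_alg"]
    unfolding gens .

  fix \<phi> :: "(letter, 'k) free_lie \<Rightarrow> 'k U_alg"
  assume hom: "lie_hom free_lie_scale free_lie_bracket U_scale U_bracket \<phi>"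
    and u: "\<phi> (free_lie_gen letter_u) = U_x * U_y"
    and v: "\<phi> (free_lie_gen letter_v) = U_x ^ 2 * U_y"
  interpret \<phi>: Vector_Spaces.linear free_lie_scale U_scale \<phi>
    using hom by (simp add: lie_hom_def)
  have bracket: "\<phi> (free_lie_bracket a b) = U_bracket (\<phi> a) (\<phi> b)" for a b
    using hom by (simp add: lie_hom_def)
  \<comment> \<open>The image of \<open>bracket_witt_gen_1\<close> is divided by
    \<open>k - 1\<close>. This coefficient vanishes at \<open>k = 1\<close>, so index 2 is read off
    from \<open>v\<close>.\<close>
  have \<phi>_gen: "\<phi> (witt_gen k) = e_mon k" if "1 \<le> k" for k
    using that
  proof (induction k rule: nat_induct_at_least)
    case base
    then show ?case using u by (simp add: witt_gen_def)
  next
    case (Suc k)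
    show ?case
    proof (cases "k = 1")
      case True
      then have "Suc k = 2" by simp
      then show ?thesis by (simp only: v witt_gen_2)
    next
      case False
      have "U_scale (of_nat k - 1) (\<phi> (witt_gen (Suc k))) = U_scale (of_nat k - 1) (e_mon (Suc k))"
        using arg_cong[OF bracket_witt_gen_1[OF Suc.hyps], of \<phi>] u Suc.IH
          e_mon_bracket[of k 1, where 'a='k]
        by (simp add: bracket \<phi>.scale witt_gen_1[unfolded One_nat_def])
      moreover have "of_nat k - 1 \<noteq> (0 :: 'k)" using False by simp
      ultimately show ?thesis by simp
    qed
  qed
  let ?I = "free_lie.lie_ideal_generated {alpha n | n. 1 \<le> n} :: (letter, 'k) free_lie set"
  have I_ker: "?I \<subseteq> {a. \<phi> a = 0}"
  proof (rule free_lie.lie_ideal_generated_least)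
    show "{alpha n | n. 1 \<le> n} \<subseteq> {a. \<phi> a = 0}"
    proof clarify
      fix n :: nat assume n: "1 \<le> n"
      have "\<phi> (free_lie_bracket (witt_gen (n + 1)) (witt_gen (n + 2)) + witt_gen (2 * n + 3)) =
          U_scale (of_nat (n + 1) - of_nat (n + 2)) (e_mon (n + 1 + (n + 2))) + e_mon (2 * n + 3)"
        by (simp only: \<phi>.add bracket \<phi>_gen e_mon_bracket le_add2 trans_le_add2)
      also have "n + 1 + (n + 2) = 2 * n + 3" by simp
      also have "of_nat (n + 1) - of_nat (n + 2) = (-1 :: 'k)" by simp
      finally show "\<phi> (alpha n) = 0"
        by (simp add: alpha_witt_gen[OF n] \<phi>.scale)
    qed
    show "free_lie.lie_ideal {a. \<phi> a = 0}"
      by (simp add: free_lie.lie_ideal_def bracket \<phi>.subspace_kernel)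
  qed
  \<comment> \<open>Both surjectivity onto \<open>R_alg\<close> and the kernel computation thereby
    reduce to the span of the Witt generators.\<close>
  have decomp: "\<exists>s\<in>free_lie.span (witt_gen ` {1..}). a - s \<in> ?I \<and> \<phi> a = \<phi> s" for a
  proof -
    obtain s where s: "s \<in> free_lie.span (witt_gen ` {1..})" "a - s \<in> ?I"
      by (rule free_lie_spanning)
    then have "\<phi> (a - s) = 0" using I_ker by auto
    then show ?thesis using s by (auto simp: \<phi>.diff)
  qed
  have "R_alg = \<phi> ` free_lie.span (witt_gen ` {1..})"
    unfolding R_alg \<phi>.span_image[symmetric] image_image using \<phi>_gen
    by (intro arg_cong[where f = U_alg.span]) auto
  then show "range \<phi> = R_alg" using decomp by blast

  \<comment> \<open>The coefficients depend only on \<open>\<phi> s\<close>, so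
    \<open>\<phi>\<close> is injective on the span. Allowing every large \<open>n\<close> lets the
    induction use one common bound.\<close>
  have expansion: "\<exists>N. \<forall>n\<ge>N. s = (\<Sum>k=1..n. free_lie_scale (e_coeff k (\<phi> s)) (witt_gen k))"
    if "s \<in> free_lie.span (witt_gen ` {1..})" for s
    using that
  proof (induction rule: free_lie.span_induct_alt)
    case base
    show ?case by simp
  next
    case (step c a s)
    then obtain j N where j: "a = witt_gen j" "1 \<le> j"
      and N: "\<forall>n\<ge>N. s = (\<Sum>k=1..n. free_lie_scale (e_coeff k (\<phi> s)) (witt_gen k))"
      by auto
    show ?case
    proof (intro exI[of _ "max N j"] allI impI)
      fix n assume n: "max N j \<le> n"
      \<comment> \<open>By duality the added multiple of \<open>witt_gen j\<close> changes only the
        coefficient at \<open>j\<close>, and \<open>j <= n\<close> ensures that this index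
        occurs.\<close>
      have "(\<Sum>k=1..n. free_lie_scale (e_coeff k (\<phi> (free_lie_scale c a + s))) (witt_gen k)) =
          (\<Sum>k=1..n. (if k = j then free_lie_scale c (witt_gen j) else 0))
          + (\<Sum>k=1..n. free_lie_scale (e_coeff k (\<phi> s)) (witt_gen k))"
        unfolding sum.distrib[symmetric]
        by (rule sum.cong)
          (auto simp: \<phi>.add \<phi>.scale e_coeff_add e_coeff_scale e_coeff_e_mon \<phi>_gen[OF j(2)] j(1)
            free_lie.scale_left_distrib)
      also have "\<dots> = free_lie_scale c a + s"
        using N n j by (simp add: sum.delta)
      finally show "free_lie_scale c a + s =
          (\<Sum>k=1..n. free_lie_scale (e_coeff k (\<phi> (free_lie_scale c a + s))) (witt_gen k))" ..
    qed
  qed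
  have "a \<in> ?I" if "\<phi> a = 0" for a
  proof -
    obtain s where s: "s \<in> free_lie.span (witt_gen ` {1..})" "a - s \<in> ?I" "\<phi> s = 0"
      using decomp[of a] \<open>\<phi> a = 0\<close> by auto
    have "s = 0" using expansion[OF s(1)] s(3) by auto
    then show ?thesis using s(2) by simp
  qed
  then show "{a. \<phi> a = 0} = ?I" using I_ker by auto
qed

end
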